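(* Let $C$ be a diamond category with countably many isomorphism classes, $\mathcal{P}$ its category of pro-objects, and $\mu$ a probability measure on $\mathcal{P}/\cong$ with finite moments $M_G=\int_{\mathcal{P}}\#\mathrm{Epi}(\mathscr{G},G)\,d\mu(\mathscr{G})<\infty$ for every $G\in C/\cong$. Let $(f_n)_{n\ge1}$, $f_n:C/\cong\to\mathbb{R}$, be a real-valued $L^1$-ordering with respect to $\mu$ such that $\liminf_{n\to\infty}\left|\int_C f_n\,dM\right|>0$. Suppose there exist an integer $k$ and a non-decreasing function $\gamma:\mathbb{N}\to\mathbb{R}^+$ with $\lim_{t\to\infty}\gamma(t)=\infty$ such that \[ \int_{\mathcal{P}}\left|N(\mathscr{G},f_n)-\int_C f_n\,dM\right|^k d\mu(\mathscr{G}) = O\!\left(\frac{\left|\int_C f_n\,dM\right|^k}{\gamma(n)}\right)\quad (n\to\infty). \] Then: (i) (Weak Law) $N(\mathscr{G},f_n)\big/\int_C f_n\,dM \to 1$ in probability with respect to $\mu$ as $n\to\infty$. (ii) (Strong Law) If additionally $\sum_{n=1}^\infty \frac{1}{\gamma(n)}<\infty$, then $N(\mathscr{G},f_n)\big/\int_C f_n\,dM\to 1$ $\mu$-almost surely as $n\to\infty$. (iii) (Strong Law) If additionally $f_n\ge 0$ for all $n$, the function $n\mapsto N(\mathscr{G},f_n)$ is non-decreasing for $\mu$-almost every $\mathscr{G}$, and $\gamma(n)=\psi\!\left(\int_C f_n\,dM\right)$ for some non-decreasing $\psi:\mathbb{R}\to\mathbb{R}^+$ with $\sum_{n=1}^\infty\frac{1}{n\psi(n)}<\infty$,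 then $N(\mathscr{G},f_n)\big/\int_C f_n\,dM\to 1$ $\mu$-almost surely as $n\to\infty$.
   Context: A diamond category is in the sense of Sawin–Wood (Definition 1.3 of "The moment problem for random objects in a category"); in particular for objects $G$ of $C$ and pro-objects $\mathscr{G}\in\mathcal{P}$, the set $\mathrm{Epi}(\mathscr{G},G)$ of epimorphisms is finite. $\mu$ is a Borel probability measure on the set $\mathcal{P}/\cong$ of isomorphism classes of pro-objects with its level topology. $M$ denotes the discrete measure on $C/\cong$ with $M(\{G\})=M_G$, so $\int_C f\,dM=\sum_{G\in C/\cong}f(G)M_G$. An ordering is a sequence of functions $f_n:C/\cong\to\mathbb{C}$, $n\in\mathbb{Z}_{\ge1}$; it is an $L^1$-ordering with respect to $\mu$ if $\sum_{G\in C/\cong}|f_n(G)|M_G<\infty$ for each $n$. The counting function is $N(\mathscr{G},f_n)=\sum_{G\in C/\cong}f_n(G)\,\#\mathrm{Epi}(\mathscr{G},G)$ (for an $L^1$-ordering this converges absolutely for $\mu$-almost every $\mathscr{G}$ for all $n$).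
   Formalization: The integer k is taken to be non-negative; for negative k the claim is false, since the bound then forces N/∫f_n dM − 1 to be unbounded in probability. *)

theory Defs
  imports "HOL-Probability.Probability" "HOL-Algebra.Lattice" "HOL-Library.Landau_Symbols"
begin

section \<open>Small categories\<close>

record ('o, 'a) cat =
  Obj :: "'o set"
  Arr :: "'a set"
  Dom :: "'a \<Rightarrow> 'o"
  Cod :: "'a \<Rightarrow> 'o"
  Id :: "'o \<Rightarrow> 'a"
  Comp :: "'a \<Rightarrow> 'a \<Rightarrow> 'a"  \<comment> \<open>\<open>Comp C g f\<close> is \<open>g\<close> after \<open>f\<close>\<close>

definition Hom :: "('o, 'a) cat \<Rightarrow> 'o \<Rightarrow> 'o \<Rightarrow> 'a set" where
  "Hom C x y = {f \<in> Arr C. Dom C f = x \<and> Cod C f = y}"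

definition category :: "('o, 'a) cat \<Rightarrow> bool" where
  "category C \<longleftrightarrow>
    (\<forall>f\<in>Arr C. Dom C f \<in> Obj C \<and> Cod C f \<in> Obj C) \<and>
    (\<forall>x\<in>Obj C. Id C x \<in> Hom C x x) \<and>
    (\<forall>f\<in>Arr C. \<forall>g\<in>Arr C. Cod C f = Dom C g \<longrightarrow> Comp C g f \<in> Hom C (Dom C f) (Cod C g)) \<and>
    (\<forall>f\<in>Arr C. Comp C f (Id C (Dom C f)) = f \<and> Comp C (Id C (Cod C f)) f = f) \<and>
    (\<forall>f\<in>Arr C. \<forall>g\<in>Arr C. \<forall>h\<in>Arr C. Cod C f = Dom C g \<longrightarrow> Cod C g = Dom C h \<longrightarrow>
      Comp C h (Comp C g f) = Comp C (Comp C h g) f)"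

definition Epi :: "('o, 'a) cat \<Rightarrow> 'o \<Rightarrow> 'o \<Rightarrow> 'a set" where
  "Epi C x y = {e \<in> Hom C x y. \<forall>z\<in>Obj C. \<forall>g\<in>Hom C y z. \<forall>h\<in>Hom C y z.
     Comp C g e = Comp C h e \<longrightarrow> g = h}"

definition Iso :: "('o, 'a) cat \<Rightarrow> 'o \<Rightarrow> 'o \<Rightarrow> 'a set" where
  "Iso C x y = {f \<in> Hom C x y. \<exists>g\<in>Hom C y x. Comp C g f = Id C x \<and> Comp C f g = Id C y}"

definition isoclasses :: "('o, 'a) cat \<Rightarrow> 'o set set" where
  "isoclasses C = Obj C // {(x, y). x \<in> Obj C \<and> y \<in> Obj C \<and> Iso C x y \<noteq> {}}"

definition rep :: "'o set \<Rightarrow> 'o" where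
  "rep c = (SOME x. x \<in> c)"

definition full_subcategory :: "('o, 'a) cat \<Rightarrow> 'o set \<Rightarrow> ('o, 'a) cat" where
  "full_subcategory C S =
     C\<lparr>Obj := Obj C \<inter> S, Arr := {f \<in> Arr C. Dom C f \<in> S \<and> Cod C f \<in> S}\<rparr>"


section \<open>Diamond categories\<close>

text \<open>
  A quotient of \<open>G\<close> is an epimorphism out of \<open>G\<close>. Two quotients are identified if they differ by an
  isomorphism of their codomains, and \<open>H\<close> lies above \<open>F\<close> if the map to \<open>F\<close> factors through the
  one to \<open>H\<close>; so \<open>G\<close> itself is the largest quotient of \<open>G\<close>.
\<close>

definition quotients :: "('o, 'a) cat \<Rightarrow> 'o \<Rightarrow> 'a set" where
  "quotients C G = (\<Union>F\<in>Obj C. Epi C G F)"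

definition quot_ge :: "('o, 'a) cat \<Rightarrow> 'a \<Rightarrow> 'a \<Rightarrow> bool" where
  "quot_ge C p q \<longleftrightarrow> (\<exists>h\<in>Hom C (Cod C p) (Cod C q). Comp C h p = q)"

definition quot_class :: "('o, 'a) cat \<Rightarrow> 'o \<Rightarrow> 'a \<Rightarrow> 'a set" where
  "quot_class C G p =
     {q \<in> quotients C G. \<exists>r\<in>Iso C (Cod C p) (Cod C q). Comp C r p = q}"

definition quot_poset :: "('o, 'a) cat \<Rightarrow> 'o \<Rightarrow> 'a set gorder" where
  "quot_poset C G =
     \<lparr>carrier = quot_class C G ` quotients C G,
      eq = (=),
      le = (\<lambda>A B. \<exists>a\<in>A. \<exists>b\<in>B. quot_ge C b a)\<rparr>"

definition modular_lattice :: "'b gorder \<Rightarrow> bool" where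
  "modular_lattice L \<longleftrightarrow> lattice L \<and>
     (\<forall>a\<in>carrier L. \<forall>b\<in>carrier L. \<forall>x\<in>carrier L.
        a \<sqsubseteq>\<^bsub>L\<^esub> b \<longrightarrow> a \<squnion>\<^bsub>L\<^esub> (x \<sqinter>\<^bsub>L\<^esub> b) = (a \<squnion>\<^bsub>L\<^esub> x) \<sqinter>\<^bsub>L\<^esub> b)"

definition minimal_object :: "('o, 'a) cat \<Rightarrow> 'o \<Rightarrow> bool" where
  "minimal_object C G \<longleftrightarrow> G \<in> Obj C \<and> card (carrier (quot_poset C G)) = 1"

text \<open>
  Sets of isomorphism classes of objects are represented by their unions, i.e. by sets of objects
  closed under isomorphism; downward closure includes closure under isomorphism.
\<close>

definition downward_closed :: "('o, 'a) cat \<Rightarrow> 'o set \<Rightarrow> bool" where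
  "downward_closed C W \<longleftrightarrow> W \<subseteq> Obj C \<and> (\<forall>G\<in>W. \<forall>p\<in>quotients C G. Cod C p \<in> W)"

definition join_closed :: "('o, 'a) cat \<Rightarrow> 'o set \<Rightarrow> bool" where
  "join_closed C W \<longleftrightarrow>
     (\<forall>G\<in>Obj C. \<forall>p\<in>quotients C G. \<forall>q\<in>quotients C G. Cod C p \<in> W \<longrightarrow> Cod C q \<in> W \<longrightarrow>
        (\<forall>j \<in> quot_class C G p \<squnion>\<^bsub>quot_poset C G\<^esub> quot_class C G q. Cod C j \<in> W))"

definition formation :: "('o, 'a) cat \<Rightarrow> 'o set \<Rightarrow> bool" where
  "formation C W \<longleftrightarrow>
     downward_closed C W \<and> join_closed C W \<and> (\<forall>G. minimal_object C G \<longrightarrow> G \<in> W)"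

definition level :: "('o, 'a) cat \<Rightarrow> 'o set \<Rightarrow> bool" where
  "level C W \<longleftrightarrow> (\<exists>V. finite V \<and> V \<subseteq> Obj C \<and> W = \<Inter>{W'. formation C W' \<and> V \<subseteq> W'})"

text \<open>An epimorphism \<open>H \<rightarrow> G\<close> is simple if the interval \<open>[G, H]\<close> of quotients of \<open>H\<close> above \<open>G\<close>
  consists of exactly the two distinct elements \<open>G\<close> and \<open>H\<close>.\<close>

definition simple_epi :: "('o, 'a) cat \<Rightarrow> 'o \<Rightarrow> 'o \<Rightarrow> 'a \<Rightarrow> bool" where
  "simple_epi C H G p \<longleftrightarrow> p \<in> Epi C H G \<and>
     quot_class C H p \<noteq> quot_class C H (Id C H) \<and>
     {A \<in> carrier (quot_poset C H). quot_class C H p \<sqsubseteq>\<^bsub>quot_poset C H\<^esub> A}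
       = {quot_class C H p, quot_class C H (Id C H)}"

definition simple_epis_to :: "('o, 'a) cat \<Rightarrow> 'o set \<Rightarrow> 'o \<Rightarrow> 'a set" where
  "simple_epis_to C W G = {p. \<exists>H\<in>W. simple_epi C H G p}"

definition iso_over :: "('o, 'a) cat \<Rightarrow> ('a \<times> 'a) set" where
  "iso_over C = {(p, q). \<exists>r\<in>Iso C (Dom C p) (Dom C q). Comp C q r = p}"

definition diamond_category :: "('o, 'a) cat \<Rightarrow> bool" where
  "diamond_category C \<longleftrightarrow> category C \<and>
     (\<forall>G\<in>Obj C. finite (carrier (quot_poset C G)) \<and> modular_lattice (quot_poset C G)) \<and>
     (\<forall>G\<in>Obj C. finite (Iso C G G)) \<and>
     (\<forall>W G. level C W \<longrightarrow> G \<in> W \<longrightarrow>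
        finite (simple_epis_to C W G //
          (iso_over C \<inter> simple_epis_to C W G \<times> simple_epis_to C W G)))"


section \<open>Pro-objects\<close>

record ('i, 'j, 'o, 'a) diagram =
  Idx :: "('i, 'j) cat"
  obj_at :: "'i \<Rightarrow> 'o"
  arr_at :: "'j \<Rightarrow> 'a"

definition cofiltered :: "('i, 'j) cat \<Rightarrow> bool" where
  "cofiltered I \<longleftrightarrow> category I \<and> Obj I \<noteq> {} \<and>
     (\<forall>i\<in>Obj I. \<forall>j\<in>Obj I. \<exists>k\<in>Obj I. Hom I k i \<noteq> {} \<and> Hom I k j \<noteq> {}) \<and>
     (\<forall>i\<in>Obj I. \<forall>j\<in>Obj I. \<forall>u\<in>Hom I i j. \<forall>v\<in>Hom I i j.
        \<exists>k\<in>Obj I. \<exists>w\<in>Hom I k i. Comp I u w = Comp I v w)"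

definition pro_object :: "('o, 'a) cat \<Rightarrow> ('i, 'j, 'o, 'a) diagram \<Rightarrow> bool" where
  "pro_object C X \<longleftrightarrow> cofiltered (Idx X) \<and>
     (\<forall>i\<in>Obj (Idx X). obj_at X i \<in> Obj C \<and> arr_at X (Id (Idx X) i) = Id C (obj_at X i)) \<and>
     (\<forall>u\<in>Arr (Idx X).
        arr_at X u \<in> Hom C (obj_at X (Dom (Idx X) u)) (obj_at X (Cod (Idx X) u))) \<and>
     (\<forall>u\<in>Arr (Idx X). \<forall>v\<in>Arr (Idx X). Cod (Idx X) u = Dom (Idx X) v \<longrightarrow>
        arr_at X (Comp (Idx X) v u) = Comp C (arr_at X v) (arr_at X u))"

text \<open>
  \<open>Hom(X, Y) = lim\<^sub>j colim\<^sub>i Hom(X\<^sub>i, Y\<^sub>j)\<close>. An element of \<open>colim\<^sub>i Hom(X\<^sub>i, G)\<close> is an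
  equivalence class of pairs \<open>(i, f)\<close> with \<open>f : X\<^sub>i \<rightarrow> G\<close>.
\<close>

definition germ_rel ::
  "('o, 'a) cat \<Rightarrow> ('i, 'j, 'o, 'a) diagram \<Rightarrow> 'o \<Rightarrow> (('i \<times> 'a) \<times> ('i \<times> 'a)) set" where
  "germ_rel C X G = {((i, f), (i', f')).
     i \<in> Obj (Idx X) \<and> i' \<in> Obj (Idx X) \<and>
     f \<in> Hom C (obj_at X i) G \<and> f' \<in> Hom C (obj_at X i') G \<and>
     (\<exists>k\<in>Obj (Idx X). \<exists>u\<in>Hom (Idx X) k i. \<exists>v\<in>Hom (Idx X) k i'.
        Comp C f (arr_at X u) = Comp C f' (arr_at X v))}"

definition germs :: "('o, 'a) cat \<Rightarrow> ('i, 'j, 'o, 'a) diagram \<Rightarrow> 'o \<Rightarrow> ('i \<times> 'a) set set" where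
  "germs C X G = (SIGMA i:Obj (Idx X). Hom C (obj_at X i) G) // germ_rel C X G"

definition pro_maps ::
  "('o, 'a) cat \<Rightarrow> ('i, 'j, 'o, 'a) diagram \<Rightarrow> ('i, 'j, 'o, 'a) diagram
     \<Rightarrow> ('i \<Rightarrow> ('i \<times> 'a) set) set" where
  "pro_maps C X Y = {\<phi> \<in> (\<Pi>\<^sub>E j\<in>Obj (Idx Y). germs C X (obj_at Y j)).
     \<forall>u\<in>Arr (Idx Y). \<forall>(i, f)\<in>\<phi> (Dom (Idx Y) u).
       (i, Comp C (arr_at Y u) f) \<in> \<phi> (Cod (Idx Y) u)}"

definition pro_id ::
  "('o, 'a) cat \<Rightarrow> ('i, 'j, 'o, 'a) diagram \<Rightarrow> 'i \<Rightarrow> ('i \<times> 'a) set" where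
  "pro_id C X = (\<lambda>j\<in>Obj (Idx X). germ_rel C X (obj_at X j) `` {(j, Id C (obj_at X j))})"

definition pro_comp ::
  "('o, 'a) cat \<Rightarrow> ('i, 'j, 'o, 'a) diagram \<Rightarrow> ('i, 'j, 'o, 'a) diagram
     \<Rightarrow> ('i \<Rightarrow> ('i \<times> 'a) set) \<Rightarrow> ('i \<Rightarrow> ('i \<times> 'a) set) \<Rightarrow> 'i \<Rightarrow> ('i \<times> 'a) set" where
  "pro_comp C X Z \<psi> \<phi> = (\<lambda>l\<in>Obj (Idx Z).
     \<Union>{germ_rel C X (obj_at Z l) `` {(i, Comp C g f)} | i f j g. (j, g) \<in> \<psi> l \<and> (i, f) \<in> \<phi> j})"

type_synonym ('i, 'j, 'o, 'a) pro_arrow =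
  "('i, 'j, 'o, 'a) diagram \<times> ('i, 'j, 'o, 'a) diagram \<times> ('i \<Rightarrow> ('i \<times> 'a) set)"

definition Pro ::
  "('o, 'a) cat \<Rightarrow> (('i, 'j, 'o, 'a) diagram, ('i, 'j, 'o, 'a) pro_arrow) cat" where
  "Pro C =
     \<lparr>Obj = {X. pro_object C X},
      Arr = {(X, Y, \<phi>). pro_object C X \<and> pro_object C Y \<and> \<phi> \<in> pro_maps C X Y},
      Dom = (\<lambda>(X, Y, \<phi>). X),
      Cod = (\<lambda>(X, Y, \<phi>). Y),
      Id = (\<lambda>X. (X, X, pro_id C X)),
      Comp = (\<lambda>(_, Z, \<psi>) (X, _, \<phi>). (X, Z, pro_comp C X Z \<psi> \<phi>))\<rparr>"

text \<open>An object of \<open>C\<close> as a pro-object: the diagram on the category with one object and one arrow.\<close>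

definition const_pro :: "('o, 'a) cat \<Rightarrow> 'o \<Rightarrow> ('i, 'j, 'o, 'a) diagram" where
  "const_pro C G =
     \<lparr>Idx = \<lparr>Obj = {undefined}, Arr = {undefined}, Dom = (\<lambda>_. undefined), Cod = (\<lambda>_. undefined),
             Id = (\<lambda>_. undefined), Comp = (\<lambda>_ _. undefined)\<rparr>,
      obj_at = (\<lambda>_. G),
      arr_at = (\<lambda>_. Id C G)\<rparr>"

text \<open>\<open>is_level_quotient C W X F\<close> says that \<open>F\<close> is (isomorphic to) the maximal quotient \<open>X\<^sup>W\<close>
  of \<open>X\<close> in the level \<open>W\<close>.\<close>

definition is_level_quotient ::
  "('o, 'a) cat \<Rightarrow> 'o set \<Rightarrow> ('i, 'j, 'o, 'a) diagram \<Rightarrow> 'o \<Rightarrow> bool" where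
  "is_level_quotient C W X F \<longleftrightarrow> F \<in> W \<and>
     (\<exists>p\<in>Epi (Pro C) X (const_pro C F).
        \<forall>G\<in>W. \<forall>q\<in>Epi (Pro C) X (const_pro C G). quot_ge (Pro C) p q)"

text \<open>
  The pro-objects considered are those that have a maximal quotient in every level. This is what the
  level topology refers to. It implies that \<open>X\<close> has finitely many epimorphisms to each \<open>G\<close>, since
  these factor through \<open>X\<^sup>W\<close> for the level \<open>W\<close> generated by \<open>G\<close>.
\<close>

definition pro_category ::
  "('o, 'a) cat \<Rightarrow> (('i, 'j, 'o, 'a) diagram, ('i, 'j, 'o, 'a) pro_arrow) cat" where
  "pro_category C =
     full_subcategory (Pro C) {X. \<forall>W. level C W \<longrightarrow> (\<exists>F. is_level_quotient C W X F)}"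

definition level_topology ::
  "('o, 'a) cat \<Rightarrow> ('i, 'j, 'o, 'a) diagram set topology" where
  "level_topology C = topology_generated_by
     {{c \<in> isoclasses (pro_category C). is_level_quotient C W (rep c) F} | W F.
        level C W \<and> F \<in> W}"

definition borel_level_measure ::
  "('o, 'a) cat \<Rightarrow> ('i, 'j, 'o, 'a) diagram set measure \<Rightarrow> bool" where
  "borel_level_measure C \<mu> \<longleftrightarrow>
     space \<mu> = isoclasses (pro_category C) \<and>
     sets \<mu> = sigma_sets (isoclasses (pro_category C)) {U. openin (level_topology C) U}"


section \<open>Moments and counting functions\<close>

text \<open>Here \<open>c\<close> is an isomorphism class of pro-objects and \<open>g\<close> one of objects of \<open>C\<close>.\<close>

definition num_epi :: "('o, 'a) cat \<Rightarrow> ('i, 'j, 'o, 'a) diagram set \<Rightarrow> 'o set \<Rightarrow> nat" where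
  "num_epi C c g = card (Epi (pro_category C) (rep c) (const_pro C (rep g)))"

definition moment ::
  "('o, 'a) cat \<Rightarrow> ('i, 'j, 'o, 'a) diagram set measure \<Rightarrow> 'o set \<Rightarrow> real" where
  "moment C \<mu> g = (LINT c|\<mu>. real (num_epi C c g))"

definition finite_moments ::
  "('o, 'a) cat \<Rightarrow> ('i, 'j, 'o, 'a) diagram set measure \<Rightarrow> bool" where
  "finite_moments C \<mu> \<longleftrightarrow>
     (\<forall>g\<in>isoclasses C. integrable \<mu> (\<lambda>c. real (num_epi C c g)))"

definition moment_measure ::
  "('o, 'a) cat \<Rightarrow> ('i, 'j, 'o, 'a) diagram set measure \<Rightarrow> 'o set measure" where
  "moment_measure C \<mu> = point_measure (isoclasses C) (\<lambda>g. ennreal (moment C \<mu> g))"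

text \<open>Orderings are indexed by \<open>n \<ge> 1\<close>; the value at \<open>0\<close> plays no role.\<close>

definition L1_ordering ::
  "('o, 'a) cat \<Rightarrow> ('i, 'j, 'o, 'a) diagram set measure \<Rightarrow> (nat \<Rightarrow> 'o set \<Rightarrow> real) \<Rightarrow> bool" where
  "L1_ordering C \<mu> f \<longleftrightarrow>
     (\<forall>n\<ge>1. (\<lambda>g. \<bar>f n g\<bar> * moment C \<mu> g) summable_on isoclasses C)"

definition counting ::
  "('o, 'a) cat \<Rightarrow> ('i, 'j, 'o, 'a) diagram set \<Rightarrow> ('o set \<Rightarrow> real) \<Rightarrow> real" where
  "counting C c h = (\<Sum>\<^sub>\<infinity>g\<in>isoclasses C. h g * real (num_epi C c g))"

definition tendsto_in_probability ::
  "'b measure \<Rightarrow> (nat \<Rightarrow> 'b \<Rightarrow> real) \<Rightarrow> real \<Rightarrow> bool" where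
  "tendsto_in_probability M X l \<longleftrightarrow>
     (\<forall>\<epsilon>>0. (\<lambda>n. measure M {\<omega> \<in> space M. \<epsilon> < \<bar>X n \<omega> - l\<bar>}) \<longlonglongrightarrow> 0)"

end

theory Submission
  imports Defs
begin

text \<open>
  Markov's inequality bounds the probability that \<open>N(_, f\<^sub>n) / m n\<close> is farther than \<open>\<epsilon>\<close> from 1 by
  \<open>O(1 / \<gamma> n)\<close>; this is the weak law, and Borel--Cantelli gives almost sure convergence along every
  index sequence on which \<open>1 / \<gamma>\<close> is summable. In the monotone case, Tonelli identifies \<open>m n\<close> with the mean
  of \<open>N(_, f\<^sub>n)\<close>, so \<open>m\<close> is non-decreasing too. Divide the indices into the blocks on which \<open>m\<close>
  lies between consecutive powers of \<open>\<alpha> = 2 powr (1 / p)\<close>. By Cauchy condensation \<open>1 / \<gamma>\<close> is summable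
  along the first and along the last indices of the blocks. Both are needed because \<open>m\<close> may jump by
  more than a factor \<open>\<alpha>\<close> between blocks. Monotonicity interpolates within a block up to a
  factor \<open>\<alpha>\<close>, which tends to 1 as \<open>p\<close> grows.
\<close>

section \<open>Summability along geometric thresholds\<close>

text \<open>Every value \<open>g i\<close> occurs exactly \<open>p\<close> times. Padding a partial
  sum to \<open>N * p\<close> terms adds only nonnegative ones and groups it into \<open>N\<close>
  constant runs, whence the bound by \<open>p\<close> times the sum of \<open>g\<close>.\<close>

lemma summable_div_blocks:
  fixes g :: "nat \<Rightarrow> real"
  assumes "summable g" and nonneg: "\<And>i. g i \<ge> 0" and "p > 0"
  shows "summable (\<lambda>j. g (j div p))"
proof (rule summableI_nonneg_bounded)
  fix N
  have "(\<Sum>j<N. g (j div p)) \<le> (\<Sum>j<N * p. g (j div p))"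
    using \<open>p > 0\<close> by (intro sum_mono2) (auto simp: nonneg less_le_trans)
  also have "\<dots> = (\<Sum>i<N. \<Sum>j=i*p..<i*p+p. g (j div p))"
    by (rule sum.nat_group[symmetric])
  also have "\<dots> = (\<Sum>i<N. \<Sum>j=i*p..<i*p+p. g i)"
  proof (intro sum.cong refl)
    fix i j assume "j \<in> {i*p..<i*p+p}"
    then have "j div p = i"
      by (intro div_nat_eqI) (auto simp: algebra_simps)
    then show "g (j div p) = g i" by simp
  qed
  also have "\<dots> = real p * (\<Sum>i<N. g i)"
    by (simp add: sum_distrib_left)
  also have "\<dots> \<le> real p * suminf g"
    using assms by (intro mult_left_mono sum_le_suminf) auto
  finally show "(\<Sum>j<N. g (j div p)) \<le> real p * suminf g" .
qed (rule nonneg)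

text \<open>Cauchy condensation gives summability at the powers of 2. Exponents in between are
  rounded down to \<open>j div p\<close>; by monotonicity of \<psi> this only enlarges the terms,
  and each of them occurs \<open>p\<close> times.\<close>

lemma summable_inverse_geometric:
  fixes \<psi> :: "real \<Rightarrow> real"
  assumes mono: "mono \<psi>" and pos: "\<And>x. \<psi> x > 0" and "p > 0"
    and sum: "summable (\<lambda>n. 1 / (real (Suc n) * \<psi> (real (Suc n))))"
  shows "summable (\<lambda>j. 1 / \<psi> (2 powr (real j / real p)))"
proof (rule summable_comparison_test_ev)
  let ?h = "\<lambda>n. 1 / (real n * \<psi> (real n))"
  have "summable ?h"
    using sum by (subst summable_Suc_iff[symmetric])
  moreover have "summable ?h \<longleftrightarrow> summable (\<lambda>n. 2 ^ n * ?h (2 ^ n))"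
  proof (rule condensation_test)
    fix n :: nat assume "n > 0"
    then show "?h (Suc n) \<le> ?h n"
      using pos by (intro divide_left_mono mult_mono monoD[OF mono]) (auto simp: less_imp_le)
  qed (simp add: pos less_imp_le)
  \<comment> \<open>The condensation weight \<open>2 ^ n\<close> cancels the factor \<open>n\<close>
    of \<open>?h\<close> at \<open>2 ^ n\<close>.\<close>
  ultimately have "summable (\<lambda>n. 1 / \<psi> (2 ^ n))"
    by simp
  then show "summable (\<lambda>j. 1 / \<psi> (2 ^ (j div p)))"
    using \<open>p > 0\<close> pos by (intro summable_div_blocks) (auto simp: less_imp_le)
  show "\<forall>\<^sub>F j in sequentially. norm (1 / \<psi> (2 powr (real j / real p))) \<le> 1 / \<psi> (2 ^ (j div p))"
  proof (rule always_eventually, rule allI)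
    fix j
    have "(2::real) ^ (j div p) = 2 powr real (j div p)"
      by (simp add: powr_realpow)
    also have "\<dots> \<le> 2 powr (real j / real p)"
      using of_nat_div_le_of_nat[of j p] by simp
    finally show "norm (1 / \<psi> (2 powr (real j / real p))) \<le> 1 / \<psi> (2 ^ (j div p))"
      using pos by (auto intro!: divide_left_mono monoD[OF mono] simp: less_imp_le abs_of_pos)
  qed
qed

section \<open>Deviation probabilities and almost sure convergence along index sequences\<close>

text \<open>Markov's inequality for the \<open>k\<close>-th power, with
  \<open>K = c / \<epsilon> ^ k\<close> for the constant \<open>c\<close> of the big-O bound.
  \<open>X n\<close> itself is not assumed measurable, so measurability of the event belongs to the
  conclusion: the event is a superlevel set of the integrable \<open>k\<close>-th power.\<close>

lemma (in prob_space) deviation_bound: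
  fixes X :: "nat \<Rightarrow> 'a \<Rightarrow> real" and m \<gamma> :: "nat \<Rightarrow> real"
  assumes nz: "\<forall>\<^sub>F n in sequentially. m n \<noteq> 0"
    and gamma: "filterlim \<gamma> at_top sequentially"
    and int: "\<forall>\<^sub>F n in sequentially. integrable M (\<lambda>\<omega>. \<bar>X n \<omega> - m n\<bar> ^ k)"
    and bound: "(\<lambda>n. LINT \<omega>|M. \<bar>X n \<omega> - m n\<bar> ^ k) \<in> O(\<lambda>n. \<bar>m n\<bar> ^ k / \<gamma> n)"
    and "\<epsilon> > 0"
  shows "\<exists>K. \<forall>\<^sub>F n in sequentially. {\<omega>\<in>space M. \<epsilon> < \<bar>X n \<omega> / m n - 1\<bar>} \<in> events \<and>
    prob {\<omega>\<in>space M. \<epsilon> < \<bar>X n \<omega> / m n - 1\<bar>} \<le> K / \<gamma> n"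
proof -
  obtain c where c: "\<forall>\<^sub>F n in sequentially.
      norm (LINT \<omega>|M. \<bar>X n \<omega> - m n\<bar> ^ k) \<le> c * norm (\<bar>m n\<bar> ^ k / \<gamma> n)"
    using landau_o.bigE[OF bound] by blast
  have gamma_pos: "\<forall>\<^sub>F n in sequentially. \<gamma> n > 0"
    using gamma by (simp add: filterlim_at_top_dense)
  \<comment> \<open>For \<open>k = 0\<close> the integral is 1 and the bound would keep \<gamma>
    below \<open>c\<close>, although \<gamma> tends to infinity. A positive \<open>k\<close> allows
    the deviation to be compared through its \<open>k\<close>-th power.\<close>
  have "k > 0"
  proof (rule ccontr)
    assume "\<not> k > 0"
    have "\<forall>\<^sub>F n in sequentially. \<gamma> n > c"
      using gamma by (simp add: filterlim_at_top_dense)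
    with c gamma_pos have "\<forall>\<^sub>F n in sequentially. \<gamma> n \<noteq> \<gamma> n"
      by eventually_elim (use \<open>\<not> k > 0\<close> in \<open>simp add: prob_space field_simps\<close>)
    then show False by simp
  qed
  have "\<forall>\<^sub>F n in sequentially. {\<omega>\<in>space M. \<epsilon> < \<bar>X n \<omega> / m n - 1\<bar>} \<in> events \<and>
    prob {\<omega>\<in>space M. \<epsilon> < \<bar>X n \<omega> / m n - 1\<bar>} \<le> (c / \<epsilon> ^ k) / \<gamma> n"
    using nz int c gamma_pos
  proof eventually_elim
    case (elim n)
    let ?A = "{\<omega>\<in>space M. \<epsilon> < \<bar>X n \<omega> / m n - 1\<bar>}"
    let ?u = "\<lambda>\<omega>. \<bar>X n \<omega> - m n\<bar> ^ k"
    have "\<epsilon> < \<bar>X n \<omega> / m n - 1\<bar> \<longleftrightarrow> (\<epsilon> * \<bar>m n\<bar>) ^ k < ?u \<omega>" for \<omega>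
    proof -
      have "\<bar>X n \<omega> / m n - 1\<bar> = \<bar>X n \<omega> - m n\<bar> / \<bar>m n\<bar>"
        using elim(1) by (simp add: field_simps flip: abs_divide)
      then have "\<epsilon> < \<bar>X n \<omega> / m n - 1\<bar> \<longleftrightarrow> \<epsilon> * \<bar>m n\<bar> < \<bar>X n \<omega> - m n\<bar>"
        using elim(1) by (simp add: pos_less_divide_eq)
      also have "\<dots> \<longleftrightarrow> (\<epsilon> * \<bar>m n\<bar>) ^ k < ?u \<omega>"
        unfolding not_le[symmetric] using \<open>k > 0\<close> \<open>\<epsilon> > 0\<close> by (subst power_mono_iff) auto
      finally show ?thesis .
    qed
    then have A: "?A = {\<omega>\<in>space M. (\<epsilon> * \<bar>m n\<bar>) ^ k < ?u \<omega>}"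
      by simp
    have meas: "?u \<in> borel_measurable M"
      using elim(2) by (rule borel_measurable_integrable)
    have "?A \<in> events"
      unfolding A using meas by measurable
    moreover have "prob ?A \<le> prob {\<omega>\<in>space M. (\<epsilon> * \<bar>m n\<bar>) ^ k \<le> ?u \<omega>}"
      unfolding A using meas by (intro finite_measure_mono) (auto, measurable)
    moreover have "\<dots> \<le> (LINT \<omega>|M. ?u \<omega>) / (\<epsilon> * \<bar>m n\<bar>) ^ k"
      using elim \<open>\<epsilon> > 0\<close> by (intro integral_Markov_inequality_measure[where A = "{}"]) auto
    moreover have "\<dots> \<le> (c * (\<bar>m n\<bar> ^ k / \<gamma> n)) / (\<epsilon> * \<bar>m n\<bar>) ^ k"
      using elim \<open>\<epsilon> > 0\<close> by (intro divide_right_mono) auto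
    moreover have "\<dots> = (c / \<epsilon> ^ k) / \<gamma> n"
      using elim \<open>\<epsilon> > 0\<close> by (simp add: power_mult_distrib)
    ultimately show ?case by linarith
  qed
  then show ?thesis ..
qed

text \<open>Borel-Cantelli for each tolerance. The sequence \<open>s\<close> is a parameter so that
  one argument serves all indices as well as the two ends of the blocks; it may repeat indices, as
  the block ends can where blocks are empty.\<close>

lemma (in prob_space) AE_tendsto_along:
  fixes X :: "nat \<Rightarrow> 'a \<Rightarrow> real" and m \<gamma> :: "nat \<Rightarrow> real"
  assumes nz: "\<forall>\<^sub>F n in sequentially. m n \<noteq> 0"
    and gamma: "filterlim \<gamma> at_top sequentially"
    and int: "\<forall>\<^sub>F n in sequentially. integrable M (\<lambda>\<omega>. \<bar>X n \<omega> - m n\<bar> ^ k)"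
    and bound: "(\<lambda>n. LINT \<omega>|M. \<bar>X n \<omega> - m n\<bar> ^ k) \<in> O(\<lambda>n. \<bar>m n\<bar> ^ k / \<gamma> n)"
    and s: "filterlim s at_top sequentially"
    and sum: "summable (\<lambda>j. 1 / \<gamma> (s j))"
  shows "AE \<omega> in M. (\<lambda>j. X (s j) \<omega> / m (s j)) \<longlonglongrightarrow> 1"
proof -
  have "AE \<omega> in M. \<forall>\<^sub>F j in sequentially. \<bar>X (s j) \<omega> / m (s j) - 1\<bar> \<le> \<epsilon>" if "\<epsilon> > 0" for \<epsilon>
  proof -
    define A where "A n = {\<omega>\<in>space M. \<epsilon> < \<bar>X n \<omega> / m n - 1\<bar>}" for n
    obtain K where "\<forall>\<^sub>F n in sequentially. A n \<in> events \<and> prob (A n) \<le> K / \<gamma> n"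
      using deviation_bound[OF nz gamma int bound \<open>\<epsilon> > 0\<close>] unfolding A_def by blast
    then have "\<forall>\<^sub>F j in sequentially. A (s j) \<in> events \<and> prob (A (s j)) \<le> K / \<gamma> (s j)"
      using s by (rule eventually_compose_filterlim)
    then obtain J where J: "A (s j) \<in> events" "prob (A (s j)) \<le> K / \<gamma> (s j)" if "j \<ge> J" for j
      by (auto simp: eventually_sequentially)
    \<comment> \<open>The events are known to be measurable and small only from \<open>J\<close> on,
      so Borel-Cantelli is applied to the shifted sequence.\<close>
    have "summable (\<lambda>j. K * (1 / \<gamma> (s (j + J))))"
      using sum by (intro summable_mult) (subst summable_iff_shift)
    then have "summable (\<lambda>j. prob (A (s (j + J))))"
      by (rule summable_comparison_test'[where N = 0]) (use J in simp)
    then have "AE \<omega> in M. \<forall>\<^sub>F j in sequentially. \<omega> \<in> space M - A (s (j + J))"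
      using J by (intro borel_cantelli_AE1) (auto simp: less_top[symmetric])
    then show ?thesis
    proof eventually_elim
      case (elim \<omega>)
      then have "\<forall>\<^sub>F j in sequentially. \<bar>X (s (j + J)) \<omega> / m (s (j + J)) - 1\<bar> \<le> \<epsilon>"
        by eventually_elim (auto simp: A_def)
      then show ?case
        by (subst (asm) eventually_sequentially_seg)
    qed
  qed
  \<comment> \<open>Tolerances of the form \<open>1 / Suc i\<close> suffice, which leaves only
    countably many null sets to unite.\<close>
  then have "AE \<omega> in M. \<forall>i. \<forall>\<^sub>F j in sequentially.
      \<bar>X (s j) \<omega> / m (s j) - 1\<bar> \<le> 1 / real (Suc i)"
    by (subst AE_all_countable) auto
  then show ?thesis
  proof eventually_elim
    case (elim \<omega>)
    show ?case
    proof (rule tendstoI)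
      fix e :: real assume "e > 0"
      then obtain i where i: "1 / real (Suc i) < e"
        by (rule nat_approx_posE)
      from elim show "\<forall>\<^sub>F j in sequentially. dist (X (s j) \<omega> / m (s j)) 1 < e"
        by (rule allE[of _ i], elim eventually_mono) (use i in \<open>auto simp: dist_real_def\<close>)
    qed
  qed
qed


section \<open>Blocks of indices between consecutive powers of \<alpha>\<close>

text \<open>The search starts at 1 because orderings do: nothing is known about
  \<open>m 0\<close>.\<close>

definition first_reaching :: "(nat \<Rightarrow> real) \<Rightarrow> real \<Rightarrow> nat" where
  "first_reaching m t = (LEAST n. 1 \<le> n \<and> t \<le> m n)"

lemma first_reaching:
  assumes "filterlim m at_top sequentially"
  shows "1 \<le> first_reaching m t" "t \<le> m (first_reaching m t)"
proof -
  have "\<forall>\<^sub>F n in sequentially. t \<le> m n"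
    using assms by (simp add: filterlim_at_top)
  then obtain N where "\<And>n. n \<ge> N \<Longrightarrow> t \<le> m n"
    by (auto simp: eventually_sequentially)
  then have "1 \<le> max 1 N \<and> t \<le> m (max 1 N)" by simp
  then have "1 \<le> first_reaching m t \<and> t \<le> m (first_reaching m t)"
    unfolding first_reaching_def by (rule LeastI)
  then show "1 \<le> first_reaching m t" "t \<le> m (first_reaching m t)" by auto
qed

lemma first_reaching_le: "1 \<le> n \<Longrightarrow> t \<le> m n \<Longrightarrow> first_reaching m t \<le> n"
  unfolding first_reaching_def by (rule Least_le) simp

lemma less_first_reaching: "1 \<le> n \<Longrightarrow> n < first_reaching m t \<Longrightarrow> m n < t"
  using first_reaching_le[of n t m] by linarith

text \<open>Once the threshold exceeds \<open>m N\<close>, monotonicity prevents every index from 1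
  to \<open>N\<close> from reaching it.\<close>

lemma filterlim_first_reaching:
  assumes "mono_on {1..} m" "filterlim m at_top sequentially"
    and "filterlim t at_top sequentially"
  shows "filterlim (\<lambda>j. first_reaching m (t j)) at_top sequentially"
  unfolding filterlim_at_top
proof
  fix N
  have "\<forall>\<^sub>F j in sequentially. m (max 1 N) < t j"
    using assms(3) by (simp add: filterlim_at_top_dense)
  then show "\<forall>\<^sub>F j in sequentially. N \<le> first_reaching m (t j)"
  proof eventually_elim
    case (elim j)
    show ?case
    proof (rule ccontr)
      assume "\<not> ?case"
      then have "m (first_reaching m (t j)) \<le> m (max 1 N)"
        using first_reaching(1)[OF assms(2)] by (intro mono_onD[OF assms(1)]) auto
      then show False
        using elim first_reaching(2)[OF assms(2), of "t j"] by linarith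
    qed
  qed
qed

text \<open>Consecutive thresholds differ by the factor \<alpha>, and every \<open>p\<close>-th one
  is a power of 2, which ties the blocks to condensation.\<close>

definition block_first :: "(nat \<Rightarrow> real) \<Rightarrow> nat \<Rightarrow> nat \<Rightarrow> nat" where
  "block_first m p j = first_reaching m (2 powr (real j / real p))"

text \<open>
  The last index of the block \<open>{n. 2 powr (j / p) \<le> m n < 2 powr (Suc j / p)}\<close>. For an empty block
  it is \<open>block_first m p j\<close>, so that \<open>m\<close> is at least \<open>2 powr (j / p)\<close> there in any case.
\<close>

definition block_last :: "(nat \<Rightarrow> real) \<Rightarrow> nat \<Rightarrow> nat \<Rightarrow> nat" where
  "block_last m p j = max (block_first m p j) (block_first m p (Suc j) - 1)"

lemma block_first_le_last: "block_first m p j \<le> block_last m p j"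
  by (simp add: block_last_def)

lemma filterlim_block_first:
  assumes "mono_on {1..} m" "filterlim m at_top sequentially" "p > 0"
  shows "filterlim (block_first m p) at_top sequentially"
proof -
  have "filterlim (\<lambda>j. real j / real p) at_top sequentially"
    using \<open>p > 0\<close> filterlim_tendsto_pos_mult_at_top[OF tendsto_const[of "1 / real p"] _ filterlim_real_sequentially]
    by simp
  then have "filterlim (\<lambda>j. ln 2 * (real j / real p)) at_top sequentially"
    by (intro filterlim_tendsto_pos_mult_at_top[OF tendsto_const]) simp_all
  from filterlim_compose[OF exp_at_top this]
  have "filterlim (\<lambda>j. 2 powr (real j / real p)) at_top sequentially"
    by (simp add: powr_def mult.commute)
  then show ?thesis
    unfolding block_first_def[abs_def] by (rule filterlim_first_reaching[OF assms(1,2)])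
qed

text \<open>The block of \<open>n\<close> is found by rounding \<open>p * log 2 (m n)\<close> down.
  Since it contains \<open>n\<close>, it is not empty, so its last index lies before the next block
  and the fallback in \<open>block_last\<close> does not intervene. The bound \<open>J\<close> lets
  eventual facts about block numbers be transferred to \<open>n\<close>.\<close>

lemma block_index:
  assumes "mono_on {1..} m" "filterlim m at_top sequentially" "p > 0" "1 \<le> n"
    and "2 powr (real J / real p) \<le> m n"
  obtains j where "J \<le> j" "2 powr (real j / real p) \<le> m n" "m n < 2 powr (real (Suc j) / real p)"
    "block_first m p j \<le> n" "n \<le> block_last m p j" "block_last m p j < block_first m p (Suc j)"
proof -
  have pos: "m n > 0"
    using assms(5) by (rule less_le_trans[rotated]) simp
  define L where "L = real p * log 2 (m n)"
  have L: "2 powr (real i / real p) \<le> m n \<longleftrightarrow> real i \<le> L" for i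
    using pos \<open>p > 0\<close> by (simp add: powr_le_iff L_def field_simps)
  have "real J \<le> L"
    using assms(5) L by simp
  define j where "j = nat \<lfloor>L\<rfloor>"
  \<comment> \<open>Nonnegativity ensures that \<open>nat\<close> leaves the floor of
    \<open>L\<close> unchanged.\<close>
  have "0 \<le> L"
    using \<open>real J \<le> L\<close> of_nat_0_le_iff[of J] by linarith
  then have j: "real j \<le> L" "L < real (Suc j)"
    unfolding j_def by linarith+
  have "J \<le> j"
    using \<open>real J \<le> L\<close> unfolding j_def by (rule le_nat_floor)
  have lo: "2 powr (real j / real p) \<le> m n" and hi: "m n < 2 powr (real (Suc j) / real p)"
    using j L[of j] L[of "Suc j"] by linarith+
  have first: "block_first m p j \<le> n"
    unfolding block_first_def using assms(4) lo by (rule first_reaching_le)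
  have next_first: "n < block_first m p (Suc j)"
  proof (rule ccontr)
    assume "\<not> n < block_first m p (Suc j)"
    then have "m (block_first m p (Suc j)) \<le> m n"
      unfolding block_first_def using first_reaching(1)[OF assms(2)] assms(4)
      by (intro mono_onD[OF assms(1)]) auto
    then show False
      using hi first_reaching(2)[OF assms(2)] unfolding block_first_def
      by (meson le_less_trans not_less)
  qed
  show thesis
    by (rule that[OF \<open>J \<le> j\<close> lo hi first]) (use first next_first in \<open>auto simp: block_last_def\<close>)
qed

text \<open>Within a block \<open>m\<close> varies by at most the factor \<alpha>, and the monotone
  \<open>x\<close> is enclosed by its values at the two ends; so the ratio at \<open>n\<close> is
  controlled by the ratios at the ends up to that factor. Being about a single sequence, this
  applies to each outcome separately.\<close>

lemma tendsto_ratio_of_blocks: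
  fixes x m :: "nat \<Rightarrow> real"
  assumes x: "mono_on {1..} x" and m: "mono_on {1..} m" "filterlim m at_top sequentially"
    and first: "\<And>p. p > 0 \<Longrightarrow> (\<lambda>j. x (block_first m p j) / m (block_first m p j)) \<longlonglongrightarrow> 1"
    and last: "\<And>p. p > 0 \<Longrightarrow> (\<lambda>j. x (block_last m p j) / m (block_last m p j)) \<longlonglongrightarrow> 1"
  shows "(\<lambda>n. x n / m n) \<longlonglongrightarrow> 1"
proof -
  have sandwich: "\<forall>\<^sub>F n in sequentially. (1 - \<delta>) / 2 powr (1 / real p) \<le> x n / m n \<and>
      x n / m n \<le> (1 + \<delta>) * 2 powr (1 / real p)" if "0 < \<delta>" "\<delta> \<le> 1" "p > 0" for \<delta> :: real and p
  proof -
    have "\<forall>\<^sub>F j in sequentially. 1 - \<delta> < x (block_first m p j) / m (block_first m p j)"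
      "\<forall>\<^sub>F j in sequentially. x (block_last m p j) / m (block_last m p j) < 1 + \<delta>"
      using first[OF \<open>p > 0\<close>] last[OF \<open>p > 0\<close>] \<open>0 < \<delta>\<close> by (auto intro: order_tendstoD)
    then have "\<forall>\<^sub>F j in sequentially. 1 - \<delta> < x (block_first m p j) / m (block_first m p j) \<and>
        x (block_last m p j) / m (block_last m p j) < 1 + \<delta>"
      by (rule eventually_conj)
    then obtain J where J: "1 - \<delta> < x (block_first m p j) / m (block_first m p j)"
        "x (block_last m p j) / m (block_last m p j) < 1 + \<delta>" if "j \<ge> J" for j
      by (auto simp: eventually_sequentially)
    have "\<forall>\<^sub>F n in sequentially. 2 powr (real J / real p) \<le> m n"
      using m(2) by (simp add: filterlim_at_top)
    then show ?thesis
      using eventually_ge_at_top[of 1]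
    proof eventually_elim
      case (elim n)
      obtain j where j: "J \<le> j" "2 powr (real j / real p) \<le> m n"
          "m n < 2 powr (real (Suc j) / real p)" "block_first m p j \<le> n" "n \<le> block_last m p j"
          "block_last m p j < block_first m p (Suc j)"
        using block_index[OF m \<open>p > 0\<close> elim(2,1)] by blast
      define a b t \<alpha> where "a = block_first m p j" and "b = block_last m p j"
        and "t = 2 powr (real j / real p)" and "\<alpha> = 2 powr (1 / real p)"
      have "t > 0" "\<alpha> > 0" by (simp_all add: t_def \<alpha>_def)
      have next_t: "2 powr (real (Suc j) / real p) = \<alpha> * t"
        by (simp add: t_def \<alpha>_def add_divide_distrib flip: powr_add)
      have "1 \<le> a" "t \<le> m a"
        unfolding a_def t_def block_first_def using first_reaching[OF m(2)] by blast+
      have "1 \<le> b" "a \<le> n" "n \<le> b"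
        using \<open>1 \<le> a\<close> j unfolding a_def b_def by auto
      \<comment> \<open>Here it matters that \<open>b\<close> precedes the next block: beyond a jump
        of \<open>m\<close>, the value \<open>m b\<close> could not be compared with
        \<open>m n\<close>.\<close>
      have "m b < \<alpha> * t"
        using \<open>1 \<le> b\<close> j(6) less_first_reaching[of b m] next_t
        unfolding b_def block_first_def[of m p "Suc j"] by simp
      have "t \<le> m b"
        using \<open>t \<le> m a\<close> mono_onD[OF m(1), of a b] \<open>1 \<le> a\<close> \<open>a \<le> n\<close> \<open>n \<le> b\<close> by auto
      have "x a \<le> x n" "x n \<le> x b"
        using mono_onD[OF x, of a n] mono_onD[OF x, of n b] \<open>1 \<le> a\<close> \<open>a \<le> n\<close> \<open>n \<le> b\<close> by auto
      have ab: "1 - \<delta> < x a / m a" "x b / m b < 1 + \<delta>"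
        using J[OF \<open>J \<le> j\<close>] unfolding a_def b_def by auto
      have "m n \<le> \<alpha> * t" "t \<le> m n"
        using j next_t by (auto simp: t_def)
      \<comment> \<open>Lower bound through the first index \<open>a\<close>, where
        \<open>m a\<close> is at least \<open>t\<close>. The condition
        \<open>\<delta> \<le> 1\<close> keeps the factor \<open>1 - \<delta>\<close>
        nonnegative.\<close>
      have "(1 - \<delta>) * m n \<le> (1 - \<delta>) * (\<alpha> * t)"
        using \<open>\<delta> \<le> 1\<close> \<open>m n \<le> \<alpha> * t\<close> by (intro mult_left_mono) auto
      also have "\<dots> \<le> (1 - \<delta>) * (\<alpha> * m a)"
        using \<open>\<delta> \<le> 1\<close> \<open>t \<le> m a\<close> \<open>\<alpha> > 0\<close> by (intro mult_left_mono) auto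
      also have "\<dots> = \<alpha> * ((1 - \<delta>) * m a)"
        by simp
      also have "\<dots> \<le> \<alpha> * x n"
        using ab(1) \<open>t > 0\<close> \<open>t \<le> m a\<close> \<open>x a \<le> x n\<close> \<open>\<alpha> > 0\<close>
        by (intro mult_left_mono) (auto simp: pos_less_divide_eq)
      finally have lower: "(1 - \<delta>) * m n \<le> \<alpha> * x n" .
      \<comment> \<open>Upper bound through the last index \<open>b\<close>, where
        \<open>m b\<close> is still below \<open>\<alpha> * t\<close>.\<close>
      have "x n \<le> (1 + \<delta>) * m b"
        using ab(2) \<open>t > 0\<close> \<open>t \<le> m b\<close> \<open>x n \<le> x b\<close> by (auto simp: pos_divide_less_eq)
      also have "\<dots> \<le> (1 + \<delta>) * (\<alpha> * m n)"
        using \<open>0 < \<delta>\<close> \<open>m b < \<alpha> * t\<close> \<open>t \<le> m n\<close> \<open>\<alpha> > 0\<close>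
        by (intro mult_left_mono) (auto intro: order_trans[OF less_imp_le])
      finally have "x n \<le> (1 + \<delta>) * (\<alpha> * m n)" .
      then show ?case
        unfolding \<alpha>_def[symmetric] using lower \<open>t > 0\<close> \<open>t \<le> m n\<close> \<open>\<alpha> > 0\<close>
        by (simp add: divide_le_eq le_divide_eq mult_ac)
    qed
  qed
  \<comment> \<open>One null sequence serves both as tolerance \<delta> and as exponent
    \<open>1 / p\<close>, with \<open>Suc p\<close> in place of \<open>p\<close>, so that both
    losses vanish together.\<close>
  define h where "h p = inverse (real (Suc p))" for p
  have h: "h \<longlonglongrightarrow> 0"
    unfolding h_def[abs_def] by (rule LIMSEQ_inverse_real_of_nat)
  have "(\<lambda>p. (1 - h p) / 2 powr (h p)) \<longlonglongrightarrow> (1 - 0) / 2 powr 0"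
    "(\<lambda>p. (1 + h p) * 2 powr (h p)) \<longlonglongrightarrow> (1 + 0) * 2 powr 0"
    by (intro tendsto_intros h; simp)+
  then have lims: "(\<lambda>p. (1 - h p) / 2 powr (h p)) \<longlonglongrightarrow> 1" "(\<lambda>p. (1 + h p) * 2 powr (h p)) \<longlonglongrightarrow> 1"
    by simp_all
  have bounds: "\<forall>\<^sub>F n in sequentially. (1 - h p) / 2 powr (h p) \<le> x n / m n \<and>
      x n / m n \<le> (1 + h p) * 2 powr (h p)" for p
    using sandwich[of "h p" "Suc p"] by (simp add: h_def inverse_eq_divide)
  show ?thesis
  proof (rule order_tendstoI)
    fix c :: real assume "c < 1"
    then obtain p where "c < (1 - h p) / 2 powr (h p)"
      using order_tendstoD(1)[OF lims(1)] by (auto simp: eventually_sequentially)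
    with bounds[of p] show "\<forall>\<^sub>F n in sequentially. c < x n / m n"
      by (auto elim: eventually_mono)
  next
    fix c :: real assume "1 < c"
    then obtain p where "(1 + h p) * 2 powr (h p) < c"
      using order_tendstoD(2)[OF lims(2)] by (auto simp: eventually_sequentially)
    with bounds[of p] show "\<forall>\<^sub>F n in sequentially. x n / m n < c"
      by (auto elim: eventually_mono)
  qed
qed

section \<open>Integrals against the moment measure as means of counting functions\<close>

lemma nn_integral_moment_measure:
  "(\<integral>\<^sup>+g. ennreal (h g) \<partial>moment_measure C \<mu>) =
    (\<integral>\<^sup>+g. ennreal (moment C \<mu> g) * ennreal (h g) \<partial>count_space (isoclasses C))"
  unfolding moment_measure_def point_measure_def by (subst nn_integral_density) auto

text \<open>Tonelli's theorem over the countable set of classes. Working in \<open>ennreal\<close>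
  requires no convergence of the sums, so almost sure convergence can later be deduced from this
  identity.\<close>

lemma nn_integral_moment_measure_eq_mean:
  assumes "countable (isoclasses C)" and moments: "finite_moments C \<mu>"
    and nonneg: "\<And>g. g \<in> isoclasses C \<Longrightarrow> 0 \<le> h g"
  shows "(\<integral>\<^sup>+g. ennreal (h g) \<partial>moment_measure C \<mu>) =
    (\<integral>\<^sup>+c. \<integral>\<^sup>+g. ennreal (h g * real (num_epi C c g)) \<partial>count_space (isoclasses C) \<partial>\<mu>)"
proof -
  have int: "integrable \<mu> (\<lambda>c. real (num_epi C c g))" if "g \<in> isoclasses C" for g
    using moments that by (simp add: finite_moments_def)
  have "(\<integral>\<^sup>+c. ennreal (h g * real (num_epi C c g)) \<partial>\<mu>) = ennreal (moment C \<mu> g) * ennreal (h g)"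
    if "g \<in> isoclasses C" for g
    using nn_integral_eq_integral[OF int[OF that]] borel_measurable_integrable[OF int[OF that]]
      nonneg[OF that]
    by (simp add: ennreal_mult nn_integral_cmult moment_def mult.commute)
  then have "(\<integral>\<^sup>+g. \<integral>\<^sup>+c. ennreal (h g * real (num_epi C c g)) \<partial>\<mu> \<partial>count_space (isoclasses C)) =
      (\<integral>\<^sup>+g. ennreal (h g) \<partial>moment_measure C \<mu>)"
    unfolding nn_integral_moment_measure by (intro nn_integral_cong) simp
  then show ?thesis
    using borel_measurable_integrable[OF int] assms(1)
    by (subst nn_integral_count_space_nn_integral) auto
qed

lemma integral_moment_measure:
  assumes nonneg: "\<And>g. g \<in> isoclasses C \<Longrightarrow> 0 \<le> h g"
  shows "(LINT g|moment_measure C \<mu>. h g) = enn2real (\<integral>\<^sup>+g. ennreal (h g) \<partial>moment_measure C \<mu>)"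
  unfolding moment_measure_def
  by (rule integral_eq_nn_integral) (auto simp: AE_point_measure nonneg)

lemma nn_integral_moment_measure_finite:
  assumes nonneg: "\<And>g. g \<in> isoclasses C \<Longrightarrow> 0 \<le> h g"
    and summable: "(\<lambda>g. \<bar>h g\<bar> * moment C \<mu> g) summable_on isoclasses C"
  shows "(\<integral>\<^sup>+g. ennreal (h g) \<partial>moment_measure C \<mu>) < \<infinity>"
proof -
  have moment: "0 \<le> moment C \<mu> g" for g
    by (simp add: moment_def)
  have "Infinite_Sum.abs_summable_on (\<lambda>g. \<bar>h g\<bar> * moment C \<mu> g) (isoclasses C)"
    using summable by (simp add: abs_mult moment)
  then have "(\<integral>\<^sup>+g. ennreal (\<bar>h g\<bar> * moment C \<mu> g) \<partial>count_space (isoclasses C)) < \<infinity>"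
    unfolding abs_summable_equivalent
    by (subst nn_integral_conv_infsetsum) (auto simp: moment)
  also have "(\<integral>\<^sup>+g. ennreal (\<bar>h g\<bar> * moment C \<mu> g) \<partial>count_space (isoclasses C)) =
      (\<integral>\<^sup>+g. ennreal (h g) \<partial>moment_measure C \<mu>)"
    unfolding nn_integral_moment_measure
    by (intro nn_integral_cong) (simp add: ennreal_mult moment nonneg mult.commute)
  finally show ?thesis .
qed

text \<open>A finite integral over the counting measure is absolute summability. In the divergent
  case the identity fails: the infinite sum in \<open>counting\<close> then takes the default value
  0.\<close>

lemma nn_integral_eq_counting:
  assumes nonneg: "\<And>g. g \<in> isoclasses C \<Longrightarrow> 0 \<le> h g"
    and finite: "(\<integral>\<^sup>+g. ennreal (h g * real (num_epi C c g)) \<partial>count_space (isoclasses C)) < \<infinity>"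
  shows "(\<integral>\<^sup>+g. ennreal (h g * real (num_epi C c g)) \<partial>count_space (isoclasses C)) =
    ennreal (counting C c h)"
proof -
  let ?F = "\<lambda>g. h g * real (num_epi C c g)"
  have "integrable (count_space (isoclasses C)) ?F"
    using finite nonneg by (intro integrableI_nonneg) (auto simp: AE_count_space)
  then have sum: "Infinite_Set_Sum.abs_summable_on ?F (isoclasses C)"
    by (simp add: abs_summable_on_def)
  then show ?thesis
    using nonneg nn_integral_conv_infsetsum[OF sum] by (simp add: infsetsum_infsum[OF sum] counting_def)
qed

text \<open>Countability of \<open>I\<close> makes the family jointly measurable and the counting
  measure sigma-finite, so the partial integral is measurable.\<close>

lemma borel_measurable_nn_integral_count_space:
  fixes f :: "'i \<Rightarrow> 'a \<Rightarrow> ennreal"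
  assumes "countable I" and [measurable]: "\<And>i. i \<in> I \<Longrightarrow> f i \<in> borel_measurable M"
  shows "(\<lambda>x. \<integral>\<^sup>+i. f i x \<partial>count_space I) \<in> borel_measurable M"
proof -
  interpret sigma_finite_measure "count_space I"
    using \<open>countable I\<close> by (rule sigma_finite_measure_count_space_countable)
  have "(\<lambda>(i, x). f i x) \<in> borel_measurable (count_space I \<Otimes>\<^sub>M M)"
    using \<open>countable I\<close> by (rule measurable_pair_measure_countable1) simp
  then have "(\<lambda>(x, i). f i x) \<in> borel_measurable (M \<Otimes>\<^sub>M count_space I)"
    by (subst measurable_pair_swap_iff) (simp add: case_prod_unfold)
  then show ?thesis
    by (rule borel_measurable_nn_integral)
qed

text \<open>Both integrals are means of counting functions, so an almost sure comparison of these is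
  enough; \<open>h\<close> and \<open>h'\<close> need not be comparable pointwise.\<close>

lemma integral_moment_measure_mono:
  assumes countable: "countable (isoclasses C)" and moments: "finite_moments C \<mu>"
    and nonneg: "\<And>g. g \<in> isoclasses C \<Longrightarrow> 0 \<le> h g" "\<And>g. g \<in> isoclasses C \<Longrightarrow> 0 \<le> h' g"
    and summable: "(\<lambda>g. \<bar>h g\<bar> * moment C \<mu> g) summable_on isoclasses C"
      "(\<lambda>g. \<bar>h' g\<bar> * moment C \<mu> g) summable_on isoclasses C"
    and le: "AE c in \<mu>. counting C c h \<le> counting C c h'"
  shows "(LINT g|moment_measure C \<mu>. h g) \<le> (LINT g|moment_measure C \<mu>. h' g)"
proof -
  let ?N = "\<lambda>h c. \<integral>\<^sup>+g. ennreal (h g * real (num_epi C c g)) \<partial>count_space (isoclasses C)"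
  have AE_counting: "AE c in \<mu>. ?N h c = ennreal (counting C c h)"
    if "\<And>g. g \<in> isoclasses C \<Longrightarrow> 0 \<le> h g"
      and "(\<lambda>g. \<bar>h g\<bar> * moment C \<mu> g) summable_on isoclasses C" for h
  proof -
    have "(\<integral>\<^sup>+c. ?N h c \<partial>\<mu>) \<noteq> \<infinity>"
      using nn_integral_moment_measure_finite[OF that]
        nn_integral_moment_measure_eq_mean[OF countable moments that(1)] by simp
    moreover have "?N h \<in> borel_measurable \<mu>"
      using moments by (intro borel_measurable_nn_integral_count_space[OF countable])
        (auto simp: finite_moments_def dest: borel_measurable_integrable)
    \<comment> \<open>A finite mean forces almost sure finiteness, which excludes the default value
      of \<open>counting\<close>.\<close>
    ultimately have "AE c in \<mu>. ?N h c \<noteq> \<infinity>"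
      by (rule nn_integral_PInf_AE[rotated])
    then show ?thesis
      by (rule AE_mp) (auto intro!: AE_I2 nn_integral_eq_counting[OF that(1)] simp: less_top)
  qed
  have "AE c in \<mu>. ?N h c = ennreal (counting C c h)" "AE c in \<mu>. ?N h' c = ennreal (counting C c h')"
    using AE_counting nonneg summable by blast+
  then have "AE c in \<mu>. ?N h c \<le> ?N h' c"
    using le by eventually_elim (simp add: ennreal_leI)
  then have "(\<integral>\<^sup>+c. ?N h c \<partial>\<mu>) \<le> (\<integral>\<^sup>+c. ?N h' c \<partial>\<mu>)"
    by (rule nn_integral_mono_AE)
  then have "(\<integral>\<^sup>+g. ennreal (h g) \<partial>moment_measure C \<mu>) \<le> (\<integral>\<^sup>+g. ennreal (h' g) \<partial>moment_measure C \<mu>)"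
    by (simp add: nn_integral_moment_measure_eq_mean[OF countable moments] nonneg)
  \<comment> \<open>The larger integral has to be finite here, because \<open>enn2real\<close> sends
    infinity to 0.\<close>
  then show ?thesis
    using nn_integral_moment_measure_finite[OF nonneg(2) summable(2)]
    by (simp add: integral_moment_measure nonneg enn2real_mono)
qed

section \<open>The weak law and the two strong laws for counting functions\<close>

theorem mainTheorem1:
  fixes C :: "('o, 'a) cat"
    and \<mu> :: "('i, 'j, 'o, 'a) diagram set measure"
    and f :: "nat \<Rightarrow> 'o set \<Rightarrow> real"
    and k :: nat
    and \<gamma> :: "nat \<Rightarrow> real"
  defines "m \<equiv> \<lambda>n. LINT g|moment_measure C \<mu>. f n g"
  assumes diamond: "diamond_category C"
    and countable: "countable (isoclasses C)"
    and borel: "borel_level_measure C \<mu>"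
    and prob: "prob_space \<mu>"
    and moments: "finite_moments C \<mu>"
    and ordering: "L1_ordering C \<mu> f"
    and liminf_pos: "liminf (\<lambda>n. ereal \<bar>m n\<bar>) > 0"
    and gamma_pos: "\<forall>n\<ge>1. \<gamma> n > 0"
    and gamma_mono: "mono_on {1..} \<gamma>"
    and gamma_lim: "filterlim \<gamma> at_top sequentially"
    and kth_integrable:
      "\<forall>\<^sub>F n in sequentially. integrable \<mu> (\<lambda>c. \<bar>counting C c (f n) - m n\<bar> ^ k)"
    and kth_bound:
      "(\<lambda>n. LINT c|\<mu>. \<bar>counting C c (f n) - m n\<bar> ^ k) \<in> O(\<lambda>n. \<bar>m n\<bar> ^ k / \<gamma> n)"
  shows "tendsto_in_probability \<mu> (\<lambda>n c. counting C c (f n) / m n) 1 \<and>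
    (summable (\<lambda>n. 1 / \<gamma> (Suc n)) \<longrightarrow>
      (AE c in \<mu>. (\<lambda>n. counting C c (f n) / m n) \<longlonglongrightarrow> 1)) \<and>
    ((\<forall>n\<ge>1. \<forall>g\<in>isoclasses C. f n g \<ge> 0) \<and>
     (AE c in \<mu>. mono_on {1..} (\<lambda>n. counting C c (f n))) \<and>
     (\<exists>\<psi> :: real \<Rightarrow> real. mono \<psi> \<and> (\<forall>x. \<psi> x > 0) \<and> (\<forall>n\<ge>1. \<gamma> n = \<psi> (m n)) \<and>
        summable (\<lambda>n. 1 / (real (Suc n) * \<psi> (real (Suc n))))) \<longrightarrow>
      (AE c in \<mu>. (\<lambda>n. counting C c (f n) / m n) \<longlonglongrightarrow> 1))"
proof -
  interpret prob_space \<mu> by (rule prob)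
  let ?X = "\<lambda>n c. counting C c (f n)"
  have nz: "\<forall>\<^sub>F n in sequentially. m n \<noteq> 0"
    using less_LiminfD[OF liminf_pos] by eventually_elim auto
  note along = AE_tendsto_along[OF nz gamma_lim kth_integrable kth_bound]

  have weak: "tendsto_in_probability \<mu> (\<lambda>n c. ?X n c / m n) 1"
    unfolding tendsto_in_probability_def
  proof (intro allI impI)
    fix \<epsilon> :: real assume "\<epsilon> > 0"
    obtain K where K: "\<forall>\<^sub>F n in sequentially. {c\<in>space \<mu>. \<epsilon> < \<bar>?X n c / m n - 1\<bar>} \<in> events \<and>
        prob {c\<in>space \<mu>. \<epsilon> < \<bar>?X n c / m n - 1\<bar>} \<le> K / \<gamma> n"
      using deviation_bound[OF nz gamma_lim kth_integrable kth_bound \<open>\<epsilon> > 0\<close>] by blast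
    have upper: "(\<lambda>n. K / \<gamma> n) \<longlonglongrightarrow> 0"
      using gamma_lim by (intro real_tendsto_divide_at_top[OF tendsto_const])
    have "\<forall>\<^sub>F n in sequentially. prob {c\<in>space \<mu>. \<epsilon> < \<bar>?X n c / m n - 1\<bar>} \<le> K / \<gamma> n"
      using K by eventually_elim simp
    then show "(\<lambda>n. prob {c\<in>space \<mu>. \<epsilon> < \<bar>?X n c / m n - 1\<bar>}) \<longlonglongrightarrow> 0"
      by (rule tendsto_sandwich[OF _ _ tendsto_const upper, rotated]) simp
  qed

  have strong: "AE c in \<mu>. (\<lambda>n. ?X n c / m n) \<longlonglongrightarrow> 1" if "summable (\<lambda>n. 1 / \<gamma> (Suc n))"
  proof -
    have "AE c in \<mu>. (\<lambda>j. ?X (Suc j) c / m (Suc j)) \<longlonglongrightarrow> 1"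
      by (rule along[OF filterlim_Suc that])
    then show ?thesis
      by eventually_elim (rule LIMSEQ_imp_Suc)
  qed

  have strong_mono: "AE c in \<mu>. (\<lambda>n. ?X n c / m n) \<longlonglongrightarrow> 1"
    if nonneg: "\<forall>n\<ge>1. \<forall>g\<in>isoclasses C. f n g \<ge> 0"
      and mono_X: "AE c in \<mu>. mono_on {1..} (\<lambda>n. ?X n c)"
      and \<psi>: "mono \<psi>" "\<forall>x. \<psi> x > 0" "\<forall>n\<ge>1. \<gamma> n = \<psi> (m n)"
        "summable (\<lambda>n. 1 / (real (Suc n) * \<psi> (real (Suc n))))" for \<psi> :: "real \<Rightarrow> real"
  proof -
    have mono_m: "mono_on {1..} m"
    proof (rule mono_onI)
      fix n n' :: nat assume n: "n \<in> {1..}" "n' \<in> {1..}" "n \<le> n'"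
      have le: "AE c in \<mu>. ?X n c \<le> ?X n' c"
        using mono_X by eventually_elim (rule mono_onD[OF _ n])
      show "m n \<le> m n'"
        unfolding m_def
        by (rule integral_moment_measure_mono[OF countable moments _ _ _ _ le])
          (use n nonneg ordering in \<open>auto simp: L1_ordering_def\<close>)
    qed
    \<comment> \<open>Growth of \<open>m\<close> is forced by that of \<gamma>: wherever
      \<open>m n \<le> B\<close>, monotonicity gives
      \<open>\<gamma> n \<le> \<psi> B\<close>.\<close>
    have lim_m: "filterlim m at_top sequentially"
      unfolding filterlim_at_top
    proof
      fix B
      have "\<forall>\<^sub>F n in sequentially. \<psi> B < \<gamma> n"
        using gamma_lim by (simp add: filterlim_at_top_dense)
      then show "\<forall>\<^sub>F n in sequentially. B \<le> m n"
        using eventually_ge_at_top[of 1]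
      proof eventually_elim
        case (elim n)
        then have "\<not> m n \<le> B"
          using \<psi>(3) monoD[OF \<psi>(1), of "m n" B] by auto
        then show ?case by simp
      qed
    qed
    \<comment> \<open>Any choice of indices at or after the block starts satisfies
      \<open>m (s j) \<ge> 2 powr (j / p)\<close>, so the first and the last indices are covered by
      the same summability estimate.\<close>
    have block: "AE c in \<mu>. (\<lambda>j. ?X (s j) c / m (s j)) \<longlonglongrightarrow> 1"
      if "p > 0" and s: "\<And>j. block_first m p j \<le> s j" for p s
    proof (rule along)
      show "filterlim s at_top sequentially"
        by (rule filterlim_at_top_mono[OF filterlim_block_first[OF mono_m lim_m \<open>p > 0\<close>]])
          (simp add: s)
      show "summable (\<lambda>j. 1 / \<gamma> (s j))"
      proof (rule summable_comparison_test')
        show "summable (\<lambda>j. 1 / \<psi> (2 powr (real j / real p)))"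
          using \<psi> \<open>p > 0\<close> by (intro summable_inverse_geometric) auto
        fix j
        have first: "1 \<le> block_first m p j" "2 powr (real j / real p) \<le> m (block_first m p j)"
          unfolding block_first_def using first_reaching[OF lim_m] by blast+
        then have "1 \<le> s j"
          using s[of j] by linarith
        have "m (block_first m p j) \<le> m (s j)"
          using first(1) \<open>1 \<le> s j\<close> s by (intro mono_onD[OF mono_m]) auto
        then have "\<psi> (2 powr (real j / real p)) \<le> \<gamma> (s j)"
          using first(2) \<psi>(3) \<open>1 \<le> s j\<close> by (auto intro: monoD[OF \<psi>(1)])
        then show "norm (1 / \<gamma> (s j)) \<le> 1 / \<psi> (2 powr (real j / real p))"
          using \<psi>(2) gamma_pos \<open>1 \<le> s j\<close> by (simp add: frac_le less_imp_le)
      qed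
    qed
    \<comment> \<open>As \<open>p\<close> ranges over a countable set, a single null set can be
      discarded for all \<open>p\<close>; the limit in \<open>p\<close> is then taken outcome by
      outcome.\<close>
    have "AE c in \<mu>. \<forall>p\<in>{0<..}. (\<lambda>j. ?X (block_first m p j) c / m (block_first m p j)) \<longlonglongrightarrow> 1"
      by (subst AE_ball_countable) (auto intro: block)
    moreover have "AE c in \<mu>. \<forall>p\<in>{0<..}. (\<lambda>j. ?X (block_last m p j) c / m (block_last m p j)) \<longlonglongrightarrow> 1"
      by (subst AE_ball_countable) (auto intro: block block_first_le_last)
    ultimately show ?thesis
      using mono_X
      by eventually_elim (rule tendsto_ratio_of_blocks[OF _ mono_m lim_m], auto)
  qed

  show ?thesis
    by (intro conjI impI weak, rule strong, assumption, elim conjE exE, rule strong_mono)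
qed

end
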